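(* For all $\tau\in\mathbb{H}$, $$1+l(\tau)-2l(\tau)l(2\tau)-l(\tau)l(2\tau)^2+l(\tau)^2l(2\tau)^2=0.$$
   Context: For $\tau\in\mathbb{H}$ put $q=e^{2\pi i\tau}$ and let $r(\tau)=q^{1/5}\prod_{n\ge1}\frac{(1-q^{5n-1})(1-q^{5n-4})}{(1-q^{5n-2})(1-q^{5n-3})}$ be the Rogers–Ramanujan continued fraction. Define $l(\tau)=r(2\tau)/r(\tau)^2$. *)

theory Defs
  imports "HOL-Analysis.Analysis"
begin

definition nome :: "complex \<Rightarrow> complex" where
  "nome \<tau> = exp (2 * of_real pi * \<i> * \<tau>)"

text \<open>
  The fractional power $q^{1/5}$ is $e^{2\pi i\tau/5}$, a holomorphic function of $\tau$, and not the
  principal fifth root of $q$. The product index $n \ge 1$ is written \<open>Suc n\<close>, so the natural-number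
  subtractions never truncate.
\<close>

definition rogers_ramanujan :: "complex \<Rightarrow> complex" where
  "rogers_ramanujan \<tau> = exp (2 * of_real pi * \<i> * \<tau> / 5) *
     (\<Prod>n. ((1 - nome \<tau> ^ (5 * Suc n - 1)) * (1 - nome \<tau> ^ (5 * Suc n - 4))) /
          ((1 - nome \<tau> ^ (5 * Suc n - 2)) * (1 - nome \<tau> ^ (5 * Suc n - 3))))"

definition rr_l :: "complex \<Rightarrow> complex" where
  "rr_l \<tau> = rogers_ramanujan (2 * \<tau>) / rogers_ramanujan \<tau> ^ 2"

end

theory Submission
  imports Defs "HOL-Complex_Analysis.Conformal_Mappings"
begin

text \<open>
  Put \<open>\<rho>(q) = (q, q^4; q^5) / (q^2, q^3; q^5)\<close> (infinite products) and
  \<open>L(q) = \<rho>(q^2) / \<rho>(q)^2\<close>, so that \<open>l(\<tau>) = L(q)\<close>: the fractional powers of \<open>q\<close> cancel.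
  The classical degree-two relation \<open>v - u^2 = u v^2 (v + u^2)\<close> between \<open>u = r(\<tau>)\<close> and
  \<open>v = r(2\<tau>)\<close> reads \<open>L - 1 = q \<rho>(q) \<rho>(q^2)^2 (L + 1)\<close>. To prove it, write \<open>L\<close> by the Jacobi
  triple product as a quotient \<open>X / Y\<close> of products of two theta series in the nome \<open>q^(5/2)\<close>;
  splitting the double sums by parity turns \<open>X + Y\<close> and \<open>X - Y\<close> into products of theta series
  in the nome \<open>q^5\<close>.

  Writing \<open>M = L(q^2)\<close> and eliminating \<open>\<rho>\<close> between the relations at \<open>q\<close> and \<open>q^2\<close> gives
  \<open>(L + 1)^2 (M - 1) = L (L - 1)^2 M^2 (M + 1)\<close>, whose difference of sides is, up to sign,
  \<open>(1 + L - 2 L M - L M^2 + L^2 M^2) ((L - 1) M + L + 1)\<close>. The second factor is 2 at \<open>q = 0\<close>, so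
  the first one vanishes near 0, and then on the whole unit disc by the identity theorem.
\<close>

section \<open>q-Pochhammer products and the q-binomial theorem\<close>

definition qpoch :: "complex \<Rightarrow> complex \<Rightarrow> complex" where
  "qpoch a p = (\<Prod>n. 1 - a * p ^ n)"

lemma convergent_prod_qpoch:
  fixes a p :: complex
  assumes "norm p < 1"
  shows "convergent_prod (\<lambda>n. 1 - a * p ^ n)"
proof -
  have "summable (\<lambda>n. norm ((1 - a * p ^ n) - 1))"
    using assms by (simp add: norm_mult norm_power summable_mult summable_geometric)
  then have "abs_convergent_prod (\<lambda>n. 1 - a * p ^ n)"
    by (simp add: abs_convergent_prod_conv_summable)
  then show ?thesis
    by (rule abs_convergent_prod_imp_convergent_prod)
qed

lemma qpoch_LIMSEQ:
  fixes a p :: complex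
  assumes "norm p < 1"
  shows "(\<lambda>n. \<Prod>k<n. 1 - a * p ^ k) \<longlonglongrightarrow> qpoch a p"
  using convergent_prod_LIMSEQ[OF convergent_prod_qpoch[OF assms, of a]]
  unfolding qpoch_def by (subst filterlim_sequentially_Suc[symmetric]) (simp add: lessThan_Suc_atMost)

lemma one_minus_power_nonzero:
  fixes a p :: complex
  assumes "norm a < 1" "norm p < 1"
  shows "1 - a * p ^ n \<noteq> 0"
proof -
  have "norm (a * p ^ n) \<le> norm a * 1"
    unfolding norm_mult norm_power
    by (intro mult_left_mono power_le_one) (use assms in auto)
  with assms have "norm (a * p ^ n) < 1" by simp
  then show ?thesis by auto
qed

lemma qpoch_nonzero:
  assumes "norm a < 1" "norm p < 1"
  shows "qpoch a p \<noteq> 0"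
  unfolding qpoch_def
  by (rule prodinf_nonzero[OF convergent_prod_qpoch]) (use assms one_minus_power_nonzero in auto)

lemma qpoch_mult_minus:
  assumes "norm p < 1"
  shows "qpoch a p * qpoch (-a) p = qpoch (a ^ 2) (p ^ 2)"
  unfolding qpoch_def
  by (subst prodinf_mult)
     (auto intro!: convergent_prod_qpoch prodinf_cong simp: assms convergent_prod_qpoch[of p "-a", simplified]
        algebra_simps power2_eq_square power_mult_distrib)

text \<open>A partial product of length 2n separates into its even and odd exponents; the limit is
  then taken along the even lengths.\<close>

lemma qpoch_split_even_odd:
  assumes "norm p < 1"
  shows "qpoch a p = qpoch a (p ^ 2) * qpoch (a * p) (p ^ 2)"
proof -
  have p2: "norm (p ^ 2) < 1"
    using assms by (simp add: norm_power power_less_one_iff)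
  have "(\<Prod>k<2*n. 1 - a * p ^ k) =
        (\<Prod>k<n. 1 - a * (p ^ 2) ^ k) * (\<Prod>k<n. 1 - a * p * (p ^ 2) ^ k)" for n
    by (induction n) (simp_all add: algebra_simps power_mult[symmetric])
  then have "(\<lambda>n. \<Prod>k<2*n. 1 - a * p ^ k) \<longlonglongrightarrow> qpoch a (p ^ 2) * qpoch (a * p) (p ^ 2)"
    by (simp only:) (intro tendsto_mult qpoch_LIMSEQ p2)
  moreover have "(\<lambda>n. \<Prod>k<2*n. 1 - a * p ^ k) \<longlonglongrightarrow> qpoch a p"
    by (rule filterlim_compose[OF qpoch_LIMSEQ[OF assms]]) 
       (auto intro!: filterlim_subseq strict_monoI)
  ultimately show ?thesis
    by (metis LIMSEQ_unique)
qed

text \<open>The partial products are polynomials in \<open>q\<close> and converge locally uniformly,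
  so the limit is holomorphic.\<close>

lemma holomorphic_on_qpoch:
  assumes "k > 0" "m > 0"
  shows "(\<lambda>q. qpoch (q ^ k) (q ^ m)) holomorphic_on ball 0 1"
proof (rule holomorphic_uniform_sequence)
  let ?f = "\<lambda>n q::complex. \<Prod>i<n. 1 - q ^ k * (q ^ m) ^ i"
  show "?f n holomorphic_on ball 0 1" for n
    by (intro holomorphic_intros)
  fix x :: complex assume x: "x \<in> ball 0 1"
  \<comment> \<open>\<open>R\<close> is the midpoint between \<open>norm x\<close> and 1, so the
    closed disc of radius \<open>d\<close> about \<open>x\<close> stays in
    \<open>norm y \<le> R < 1\<close>, and powers of \<open>R ^ m\<close> are a geometric majorant
    there.\<close>
  define d where "d = (1 - norm x) / 2"
  define R where "R = norm x + d"
  have d: "d > 0" and R: "0 \<le> R" "R < 1"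
    using x by (auto simp: d_def R_def field_simps)
  have sub: "norm y \<le> R" if "y \<in> cball x d" for y
  proof -
    have "norm y \<le> norm x + norm (x - y)"
      by (metis norm_minus_commute norm_triangle_sub)
    with that show ?thesis by (simp add: R_def dist_norm)
  qed
  have "uniformly_convergent_on (cball x d) ?f"
  proof (rule uniformly_convergent_on_prod')
    show "uniformly_convergent_on (cball x d) (\<lambda>N q. \<Sum>n<N. norm ((1 - q ^ k * (q ^ m) ^ n) - 1))"
    proof (rule Weierstrass_m_test')
      fix n y assume "y \<in> cball x d"
      then have y: "norm y \<le> R" by (rule sub)
      have "norm y ^ k * (norm y ^ m) ^ n \<le> 1 * (R ^ m) ^ n"
        by (intro mult_mono power_mono power_le_one) (use y R in auto)
      then show "norm (norm ((1 - y ^ k * (y ^ m) ^ n) - 1)) \<le> (R ^ m) ^ n"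
        by (simp add: norm_mult norm_power)
    next
      show "summable (\<lambda>n. (R ^ m) ^ n)"
        using R assms by (intro summable_geometric) (auto simp: power_less_one_iff)
    qed
  qed (auto intro!: continuous_intros)
  then obtain g where g: "uniform_limit (cball x d) ?f g sequentially"
    by (auto simp: uniformly_convergent_on_def)
  have "g y = qpoch (y ^ k) (y ^ m)" if y: "y \<in> cball x d" for y
  proof -
    have "norm (y ^ m) < 1"
      using sub[OF y] R assms by (simp add: norm_power power_less_one_iff)
    then have "(\<lambda>n. ?f n y) \<longlonglongrightarrow> qpoch (y ^ k) (y ^ m)"
      by (rule qpoch_LIMSEQ)
    moreover have "(\<lambda>n. ?f n y) \<longlonglongrightarrow> g y"
      using tendsto_uniform_limitI[OF g y] .
    ultimately show ?thesis by (metis LIMSEQ_unique)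
  qed
  then have "uniform_limit (cball x d) ?f (\<lambda>q. qpoch (q ^ k) (q ^ m)) sequentially"
    using g by (subst uniform_limit_cong'[where g = ?f and i = g]) auto
  moreover have "cball x d \<subseteq> ball 0 1"
    using sub R by fastforce
  ultimately show "\<exists>d>0. cball x d \<subseteq> ball 0 1 \<and>
      uniform_limit (cball x d) ?f (\<lambda>q. qpoch (q ^ k) (q ^ m)) sequentially"
    using d by blast
qed auto

section \<open>Gaussian binomials and the finite q-binomial theorem\<close>

definition qfact :: "complex \<Rightarrow> nat \<Rightarrow> complex" where
  "qfact p n = (\<Prod>k<n. 1 - p * p ^ k)"

text \<open>The Gaussian binomial coefficient: \<open>qfact p n\<close> is (p; p)_n, and the powers
  of 1 - p that distinguish it from the q-factorial cancel in the quotient. The value 0 for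
  \<open>j > N\<close> lets sums run one index too far.\<close>

definition qbinom :: "complex \<Rightarrow> nat \<Rightarrow> nat \<Rightarrow> complex" where
  "qbinom p N j = (if j \<le> N then qfact p N / (qfact p j * qfact p (N - j)) else 0)"

lemma qfact_0 [simp]: "qfact p 0 = 1"
  and qfact_Suc: "qfact p (Suc n) = qfact p n * (1 - p ^ Suc n)"
  by (simp_all add: qfact_def)

lemma qfact_nonzero:
  assumes "norm p < 1"
  shows "qfact p n \<noteq> 0"
  using assms one_minus_power_nonzero[of p p] by (simp add: qfact_def)

text \<open>The q-Pascal rule. With i = N - j - 1 it comes from 1 - p^(i+j+2) = (1 - p^(i+1)) +
  p^(i+1) (1 - p^(j+1)).\<close>

lemma qbinom_Suc_Suc:
  assumes "norm p < 1" "j \<le> N"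
  shows "qbinom p (Suc N) (Suc j) = qbinom p N (Suc j) + p ^ (N - j) * qbinom p N j"
\<comment> \<open>For \<open>j = N\<close> the coefficient \<open>qbinom p N (Suc j)\<close> is the
  default 0, and both sides equal 1.\<close>
proof (cases "j = N")
  case True
  then show ?thesis
    using assms by (simp add: qbinom_def qfact_nonzero)
next
  case False
  define i where "i = N - Suc j"
  have N: "N = Suc (i + j)" using False assms by (auto simp: i_def)
  have nz: "qfact p n \<noteq> 0" for n using assms(1) by (rule qfact_nonzero)
  have nz': "1 - p ^ Suc n \<noteq> 0" for n using nz[of "Suc n"] by (simp add: qfact_Suc)
  have "qbinom p (Suc N) (Suc j) = qfact p N * (1 - p ^ Suc i * p ^ Suc j) /
          (qfact p j * (1 - p ^ Suc j) * (qfact p i * (1 - p ^ Suc i)))"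
    by (simp add: qbinom_def N qfact_Suc power_add)
  also have "\<dots> = qfact p N / (qfact p j * (1 - p ^ Suc j) * qfact p i) +
      p ^ Suc i * (qfact p N / (qfact p j * (qfact p i * (1 - p ^ Suc i))))"
    using nz[of j] nz[of i] nz'[of i] nz'[of j] 
    by (simp add: divide_simps del: power_Suc) (simp add: algebra_simps del: power_Suc)
  also have "\<dots> = qbinom p N (Suc j) + p ^ (N - j) * qbinom p N j"
    by (simp add: qbinom_def N qfact_Suc Suc_diff_le)
  finally show ?thesis .
qed

text \<open>The finite q-binomial theorem. In the induction the new factor
  \<open>1 + x * p ^ N\<close> reproduces the q-Pascal rule.\<close>

lemma prod_eq_sum_qbinom:
  assumes "norm p < 1"
  shows "(\<Prod>k<N. 1 + x * p ^ k) = (\<Sum>j\<le>N. qbinom p N j * p ^ (j * (j - 1) div 2) * x ^ j)"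
proof (induction N)
  case 0
  then show ?case by (simp add: qbinom_def)
next
  case (Suc N)
  let ?c = "\<lambda>j. p ^ (j * (j - 1) div 2)"
  have tri: "Suc j * (Suc j - 1) div 2 = j * (j - 1) div 2 + j" for j
    by (cases j) (auto simp: algebra_simps)
  have b0: "qbinom p n 0 = 1" for n
    using assms by (simp add: qbinom_def qfact_nonzero)
  have "(\<Sum>j\<le>Suc N. qbinom p (Suc N) j * ?c j * x ^ j) =
        1 + (\<Sum>j\<le>N. qbinom p (Suc N) (Suc j) * ?c (Suc j) * x ^ Suc j)"
    by (subst sum.atMost_Suc_shift) (simp add: b0)
  also have "(\<Sum>j\<le>N. qbinom p (Suc N) (Suc j) * ?c (Suc j) * x ^ Suc j) =
      (\<Sum>j\<le>N. qbinom p N (Suc j) * ?c (Suc j) * x ^ Suc j) +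
      (\<Sum>j\<le>N. x * p ^ N * (qbinom p N j * ?c j * x ^ j))"
    unfolding sum.distrib[symmetric]
  proof (rule sum.cong[OF refl], goal_cases)
    case (1 j)
    \<comment> \<open>The triangular exponent grows by \<open>j\<close> from \<open>j\<close> to
      \<open>Suc j\<close>, which restores the \<open>j\<close> missing from
      \<open>N - j\<close>.\<close>
    then have "p ^ (N - j) * ?c (Suc j) = p ^ N * ?c j"
      unfolding tri by (simp add: power_add[symmetric])
    with 1 show ?case
      using qbinom_Suc_Suc[OF assms, of j N] by (simp add: algebra_simps)
  qed
  also have "1 + ((\<Sum>j\<le>N. qbinom p N (Suc j) * ?c (Suc j) * x ^ Suc j) +
      (\<Sum>j\<le>N. x * p ^ N * (qbinom p N j * ?c j * x ^ j))) =
      (\<Sum>j\<le>Suc N. qbinom p N j * ?c j * x ^ j) + x * p ^ N * (\<Sum>j\<le>N. qbinom p N j * ?c j * x ^ j)"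
    by (subst sum.atMost_Suc_shift) (simp add: b0 sum_distrib_left)
  also have "(\<Sum>j\<le>Suc N. qbinom p N j * ?c j * x ^ j) = (\<Sum>j\<le>N. qbinom p N j * ?c j * x ^ j)"
    by (simp add: qbinom_def)
  finally show ?case
    using Suc.IH by (simp add: algebra_simps)
qed

section \<open>The Jacobi triple product\<close>

definition theta :: "complex \<Rightarrow> complex \<Rightarrow> complex" where
  "theta q z = (\<Sum>\<^sub>\<infinity>n. q powi (n * n) * z powi n)"

text \<open>The term is (r^n w)^n and r^n w tends to 0, so the terms are eventually below
  (1/2)^n.\<close>

lemma summable_power_square:
  fixes r w :: real
  assumes "0 \<le> r" "r < 1" "0 \<le> w"
  shows "summable (\<lambda>n. r ^ (n * n) * w ^ n)"
proof (rule summable_comparison_test_ev)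
  have "(\<lambda>n. r ^ n * w) \<longlonglongrightarrow> 0 * w"
    by (intro tendsto_mult LIMSEQ_realpow_zero tendsto_const) (use assms in auto)
  then have "eventually (\<lambda>n. r ^ n * w < 1 / 2) sequentially"
    by (rule order_tendstoD) auto
  then show "eventually (\<lambda>n. norm (r ^ (n * n) * w ^ n) \<le> (1 / 2) ^ n) sequentially"
  proof eventually_elim
    case (elim n)
    then have "(r ^ n * w) ^ n \<le> (1 / 2) ^ n"
      using assms by (intro power_mono) auto
    then show ?case
      using assms by (simp add: power_mult power_mult_distrib)
  qed
qed (auto intro: summable_geometric)

lemma theta_abs_summable:
  fixes q z :: complex
  assumes "norm q < 1"
  shows "(\<lambda>n::int. norm (q powi (n * n) * z powi n)) summable_on UNIV"
proof -
  have nat: "(\<lambda>n::nat. norm (q powi (int n * int n) * w powi int n)) summable_on UNIV" for w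
  proof -
    have "summable (\<lambda>n. norm q ^ (n * n) * norm w ^ n)"
      by (rule summable_power_square) (use assms in auto)
    also have "(\<lambda>n. norm q ^ (n * n) * norm w ^ n) =
        (\<lambda>n. norm (q powi (int n * int n) * w powi int n))"
      by (simp add: norm_mult norm_power flip: of_nat_mult)
    finally show ?thesis
      by (subst summable_on_UNIV_nonneg_real_iff) auto
  qed
  \<comment> \<open>The integers are covered by two copies of the naturals; the nonpositive half is
    the one-sided series at \<open>inverse z\<close>.\<close>
  have inj: "inj_on int UNIV" "inj_on (\<lambda>n. - int n) UNIV"
    by (auto intro!: inj_onI)
  have "(\<lambda>n::int. norm (q powi (n * n) * z powi n)) summable_on range int"
    using nat[of z] by (subst summable_on_reindex[OF inj(1)]) (simp add: o_def)
  moreover have "(\<lambda>n::int. norm (q powi (n * n) * z powi n)) summable_on range (\<lambda>n. - int n)"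
    using nat[of "inverse z"]
    by (subst summable_on_reindex[OF inj(2)]) (simp add: o_def power_int_minus power_inverse)
  ultimately have "(\<lambda>n::int. norm (q powi (n * n) * z powi n)) summable_on
      (range int \<union> range (\<lambda>n. - int n))"
    by (rule summable_on_union)
  also have "range int \<union> range (\<lambda>n. - int n) = UNIV"
    by (auto intro: int_cases2)
  finally show ?thesis .
qed

lemma theta_has_sum:
  assumes "norm q < 1"
  shows "((\<lambda>n::int. q powi (n * n) * z powi n) has_sum theta q z) UNIV"
  unfolding theta_def
  by (rule has_sum_infsum) (rule abs_summable_summable[OF theta_abs_summable[OF assms]])

text \<open>This is the q-binomial theorem in base q^2 with 2n factors, recentred by j = n +
  i.\<close>

lemma finite_triple_product:
  assumes q: "norm q < 1" "q \<noteq> 0" and z: "z \<noteq> 0"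
  shows "(\<Prod>k<n. 1 + z * q * (q ^ 2) ^ k) * (\<Prod>k<n. 1 + q / z * (q ^ 2) ^ k) =
         (\<Sum>i\<in>{-int n..int n}. qbinom (q ^ 2) (2 * n) (nat (int n + i)) * (q powi (i * i) * z powi i))"
proof -
  \<comment> \<open>With this shift the powers of \<open>q\<close> in the 2n factors are the odd
    numbers from 1 - 2n to 2n - 1, symmetric about 0.\<close>
  define x where "x = z * q powi (1 - 2 * int n)"
  have q2: "norm (q ^ 2) < 1"
    using q by (simp add: norm_power power_less_one_iff)
  have pw: "(q ^ 2) ^ k = q powi (2 * int k)" for k
  proof -
    have "(q ^ 2) ^ k = q powi int (2 * k)"
      by (simp only: power_int_of_nat power_mult)
    then show ?thesis by simp
  qed
  have prod1: "(\<Prod>k<n. 1 + x * (q ^ 2) ^ k) = z ^ n * q powi (- int n * int n) *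
      (\<Prod>k<n. 1 + q / z * (q ^ 2) ^ k)"
  proof -
    \<comment> \<open>Reversing the lower half turns the factors into 1 + z q^(-1-2k). Pulling out z
      q^(-1-2k) leaves 1 + (q/z) q^(2k), and the extracted odd exponents add up to -n^2.\<close>
    have "(\<Prod>k<n. 1 + x * (q ^ 2) ^ k) = (\<Prod>k<n. 1 + x * (q ^ 2) ^ (n - Suc k))"
      by (rule prod.nat_diff_reindex[symmetric])
    also have "\<dots> = (\<Prod>k<n. z * q powi (- 1 - 2 * int k) * (1 + q / z * (q ^ 2) ^ k))"
    proof (rule prod.cong[OF refl], goal_cases)
      case (1 k)
      then have "x * (q ^ 2) ^ (n - Suc k) = z * q powi (- 1 - 2 * int k)"
        unfolding x_def pw using q by (simp add: power_int_add[symmetric])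
      moreover have "q powi (- 1 - 2 * int k) * (q * (q ^ 2) ^ k) = 1"
        unfolding pw using q by (simp add: power_int_add power_int_diff power_int_minus)
      then have "z * q powi (- 1 - 2 * int k) * (q / z * (q ^ 2) ^ k) = 1"
        using z by (simp add: field_simps)
      ultimately show ?case by (simp add: algebra_simps)
    qed
    also have "\<dots> = (\<Prod>k<n. z * q powi (- 1 - 2 * int k)) * (\<Prod>k<n. 1 + q / z * (q ^ 2) ^ k)"
      by (rule prod.distrib)
    also have "(\<Prod>k<n. z * q powi (- 1 - 2 * int k)) = z ^ n * q powi (- int n * int n)"
    proof (induction n)
      case (Suc n)
      have eq: "q powi (- int (Suc n) * int (Suc n)) = q powi (- int n * int n) * q powi (- 1 - 2 * int n)"
        using q by (subst power_int_add[symmetric]) (auto simp: algebra_simps)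
      show ?case
        unfolding prod.lessThan_Suc Suc.IH power_Suc eq by (simp add: mult_ac)
    qed auto
    finally show ?thesis .
  qed
  have prod2: "(\<Prod>k<n. 1 + x * (q ^ 2) ^ (k + n)) = (\<Prod>k<n. 1 + z * q * (q ^ 2) ^ k)"
  proof (rule prod.cong[OF refl], goal_cases)
    case (1 k)
    have "q powi (1 - 2 * int n) * (q ^ 2) ^ (k + n) = q powi (1 + 2 * int k)"
      unfolding pw using q by (simp add: power_int_add[symmetric])
    also have "\<dots> = q * (q ^ 2) ^ k"
      unfolding pw using q by (simp add: power_int_add)
    finally show ?case by (simp add: x_def mult.assoc)
  qed
  \<comment> \<open>Completing the square: j(j-1) + (1-2n)j = (j-n)^2 - n^2.\<close>
  have summand: "(q ^ 2) ^ (j * (j - 1) div 2) * x ^ j = 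
       z ^ n * q powi (- int n * int n) * (q powi ((int j - int n) * (int j - int n)) * z powi (int j - int n))"
    for j :: nat
  proof -
    have "2 * (j * (j - 1) div 2) = j * (j - 1)"
      by (cases j) auto
    then have "(q ^ 2) ^ (j * (j - 1) div 2) = q ^ (j * (j - 1))"
      by (simp only: power_mult[symmetric])
    also have "\<dots> = q powi (int j * (int j - 1))"
      proof -
      have "q ^ (j * (j - 1)) = q powi int (j * (j - 1))"
        by (simp only: power_int_of_nat)
      also have "int (j * (j - 1)) = int j * (int j - 1)"
        by (cases j) (auto simp: algebra_simps)
      finally show ?thesis .
    qed
    finally have "(q ^ 2) ^ (j * (j - 1) div 2) * x ^ j =
        z ^ j * (q powi (int j * (int j - 1)) * q powi ((1 - 2 * int n) * int j))"
      by (simp add: x_def power_mult_distrib power_int_mult)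
    also have "q powi (int j * (int j - 1)) * q powi ((1 - 2 * int n) * int j) =
        q powi (- int n * int n) * q powi ((int j - int n) * (int j - int n))"
      using q by (simp add: power_int_add[symmetric] algebra_simps)
    also have "z ^ j = z ^ n * z powi (int j - int n)"
      using z by (simp add: power_int_diff)
    finally show ?thesis by (simp add: mult_ac)
  qed
  have "(\<Prod>k<n+n. 1 + x * (q ^ 2) ^ k) =
        (\<Prod>k<n. 1 + x * (q ^ 2) ^ k) * (\<Prod>k<n. 1 + x * (q ^ 2) ^ (k + n))"
  proof -
    have "(\<Prod>k<n+m. f k) = (\<Prod>k<n. f k) * (\<Prod>k<m. f (k + n))" for f :: "nat \<Rightarrow> complex" and m
      by (induction m) (simp_all add: mult.assoc add.commute)
    then show ?thesis .
  qed
  also have "\<dots> = z ^ n * q powi (- int n * int n) * ((\<Prod>k<n. 1 + z * q * (q ^ 2) ^ k) * (\<Prod>k<n. 1 + q / z * (q ^ 2) ^ k))"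
    unfolding prod1 prod2 by simp
  finally have "z ^ n * q powi (- int n * int n) * ((\<Prod>k<n. 1 + z * q * (q ^ 2) ^ k) * (\<Prod>k<n. 1 + q / z * (q ^ 2) ^ k)) =
     (\<Prod>k<2*n. 1 + x * (q ^ 2) ^ k)"
    by (simp add: mult_2)
  also have "\<dots> = (\<Sum>j\<le>2*n. qbinom (q ^ 2) (2 * n) j * ((q ^ 2) ^ (j * (j - 1) div 2) * x ^ j))"
    by (simp add: prod_eq_sum_qbinom[OF q2] mult.assoc)
  also have "\<dots> = z ^ n * q powi (- int n * int n) * (\<Sum>j\<le>2*n. qbinom (q ^ 2) (2 * n) j *
       (q powi ((int j - int n) * (int j - int n)) * z powi (int j - int n)))"
    unfolding summand by (simp add: sum_distrib_left mult_ac)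
  also have "(\<Sum>j\<le>2*n. qbinom (q ^ 2) (2 * n) j *
       (q powi ((int j - int n) * (int j - int n)) * z powi (int j - int n))) =
     (\<Sum>i\<in>{-int n..int n}. qbinom (q ^ 2) (2 * n) (nat (int n + i)) * (q powi (i * i) * z powi i))"
    by (rule sum.reindex_bij_witness[of _ "\<lambda>i. nat (int n + i)" "\<lambda>j. int j - int n"]) auto
  finally show ?thesis
    using q z by simp
qed

section \<open>Passage to the limit in the finite triple product\<close>

lemma qfact_LIMSEQ:
  assumes "norm p < 1"
  shows "qfact p \<longlonglongrightarrow> qpoch p p"
  using qpoch_LIMSEQ[OF assms, of p] by (simp add: qfact_def[abs_def])

text \<open>Both \<open>qfact p\<close> and its reciprocal converge, hence are bounded. The bound is
  uniform in \<open>N\<close> and \<open>j\<close>, which supplies the majorant for the exchange of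
  limit and sum below.\<close>

lemma qbinom_bounded:
  assumes "norm p < 1"
  obtains K where "\<And>N j. norm (qbinom p N j) \<le> K"
proof -
  have "Bseq (qfact p)"
    using qfact_LIMSEQ[OF assms] by (intro convergent_imp_Bseq) (auto simp: convergent_def)
  then obtain A where A: "A > 0" "\<And>n. norm (qfact p n) \<le> A"
    by (auto elim: BseqE)
  have "(\<lambda>n. inverse (qfact p n)) \<longlonglongrightarrow> inverse (qpoch p p)"
    using assms by (intro tendsto_inverse qfact_LIMSEQ qpoch_nonzero)
  then have "Bseq (\<lambda>n. inverse (qfact p n))"
    by (intro convergent_imp_Bseq) (auto simp: convergent_def)
  then obtain B where B: "B > 0" "\<And>n. norm (inverse (qfact p n)) \<le> B"
    by (auto elim: BseqE)
  have "norm (qbinom p N j) \<le> A * (B * B)" for N j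
  proof (cases "j \<le> N")
    case True
    then have "norm (qbinom p N j) =
        norm (qfact p N) * (norm (inverse (qfact p j)) * norm (inverse (qfact p (N - j))))"
      by (simp add: qbinom_def norm_mult norm_divide norm_inverse divide_inverse)
    also have "\<dots> \<le> A * (B * B)"
      by (intro mult_mono A B) (use A B in auto)
    finally show ?thesis .
  qed (use A B in \<open>auto simp: qbinom_def\<close>)
  then show ?thesis by (rule that)
qed

text \<open>Since n + i and n - i both tend to infinity, all three q-factorials tend to the same
  nonzero limit.\<close>

lemma qbinom_central_LIMSEQ:
  assumes "norm p < 1"
  shows "(\<lambda>n. qbinom p (2 * n) (nat (int n + i))) \<longlonglongrightarrow> inverse (qpoch p p)"
proof -
  have top: "filterlim (\<lambda>n. nat (int n + k)) sequentially sequentially" for k :: int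
    unfolding filterlim_at_top eventually_sequentially
  proof
    fix Z
    show "\<exists>N. \<forall>n\<ge>N. Z \<le> nat (int n + k)"
      by (intro exI[of _ "nat (int Z - k)"]) auto
  qed
  have "(\<lambda>n. qfact p (2 * n) / (qfact p (nat (int n + i)) * qfact p (nat (int n + (- i))))) \<longlonglongrightarrow>
      qpoch p p / (qpoch p p * qpoch p p)"
    using qpoch_nonzero[OF assms assms]
    by (intro tendsto_divide tendsto_mult filterlim_compose[OF qfact_LIMSEQ[OF assms] top]
          filterlim_compose[OF qfact_LIMSEQ[OF assms]] filterlim_subseq)
       (auto intro!: strict_monoI)
  also have "qpoch p p / (qpoch p p * qpoch p p) = inverse (qpoch p p)"
    using qpoch_nonzero[OF assms assms] by (simp add: field_simps)
  finally show ?thesis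
  proof (rule Lim_transform_eventually)
    show "eventually (\<lambda>n. qfact p (2 * n) / (qfact p (nat (int n + i)) * qfact p (nat (int n + (- i)))) =
        qbinom p (2 * n) (nat (int n + i))) sequentially"
      \<comment> \<open>Once n is at least the absolute value of \<open>i\<close>, neither
        \<open>nat\<close> truncates and the index lies in the range of the binomial.\<close>
      using eventually_ge_at_top[of "nat \<bar>i\<bar>"]
    proof eventually_elim
      case (elim n)
      then have "nat (int n + i) \<le> 2 * n" "2 * n - nat (int n + i) = nat (int n + (- i))"
        by linarith+
      then show ?case by (simp add: qbinom_def)
    qed
  qed
qed

theorem jacobi_triple_product:
  assumes q: "norm q < 1" "q \<noteq> 0" and z: "z \<noteq> 0"
  shows "theta q z = qpoch (q ^ 2) (q ^ 2) * (qpoch (- (z * q)) (q ^ 2) * qpoch (- (q / z)) (q ^ 2))"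
proof -
  have q2: "norm (q ^ 2) < 1"
    using q by (simp add: norm_power power_less_one_iff)
  let ?t = "\<lambda>i::int. q powi (i * i) * z powi i"
  \<comment> \<open>Padding by zeros gives the finite sums the common index set of all integers, so
    that dominated convergence applies with majorant \<open>K * norm (?t i)\<close>.\<close>
  define f where "f = (\<lambda>i n. if i \<in> {-int n..int n} then qbinom (q ^ 2) (2 * n) (nat (int n + i)) * ?t i else 0)"
  define P where "P = (\<lambda>n. (\<Prod>k<n. 1 + z * q * (q ^ 2) ^ k) * (\<Prod>k<n. 1 + q / z * (q ^ 2) ^ k))"
  obtain K where K: "\<And>N j. norm (qbinom (q ^ 2) N j) \<le> K"
    using qbinom_bounded[OF q2] by blast
  have K0: "K \<ge> 0" using K[of 0 0] norm_ge_zero order_trans by blast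
  have "P \<longlonglongrightarrow> inverse (qpoch (q ^ 2) (q ^ 2)) * theta q z"
  proof (rule swap_uniform_limit')
    show "uniform_limit UNIV (\<lambda>X n. \<Sum>i\<in>X. f i n) P (finite_subsets_at_top UNIV)"
    proof (rule Weierstrass_m_test_general')
      show "norm (f i n) \<le> K * norm (?t i)" for i n
        using K K0 by (auto simp: f_def norm_mult intro!: mult_right_mono)
      show "(\<lambda>i. K * norm (?t i)) summable_on UNIV"
        by (intro summable_on_cmult_right theta_abs_summable q)
      show "((\<lambda>i. f i n) has_sum P n) UNIV" for n
      proof -
        have "((\<lambda>i. f i n) has_sum P n) {-int n..int n}"
          unfolding P_def finite_triple_product[OF q z]
          by (rule has_sum_finiteI) (auto simp: f_def intro!: sum.cong)
        then show ?thesis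
          by (subst has_sum_cong_neutral[where T = "{-int n..int n}" and g = "\<lambda>i. f i n"]) (auto simp: f_def)
      qed
    qed
    show "\<forall>\<^sub>F X in finite_subsets_at_top UNIV.
        ((\<lambda>n. \<Sum>i\<in>X. f i n) \<longlongrightarrow> (\<Sum>i\<in>X. inverse (qpoch (q ^ 2) (q ^ 2)) * ?t i)) sequentially"
    proof (intro always_eventually allI tendsto_sum)
      fix i :: int
      have "(\<lambda>n. qbinom (q ^ 2) (2 * n) (nat (int n + i)) * ?t i) \<longlonglongrightarrow> inverse (qpoch (q ^ 2) (q ^ 2)) * ?t i"
        by (intro tendsto_mult qbinom_central_LIMSEQ q2 tendsto_const)
      moreover have "eventually (\<lambda>n. qbinom (q ^ 2) (2 * n) (nat (int n + i)) * ?t i = f i n) sequentially"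
        using eventually_ge_at_top[of "nat \<bar>i\<bar>"] by eventually_elim (auto simp: f_def)
      ultimately show "f i \<longlonglongrightarrow> inverse (qpoch (q ^ 2) (q ^ 2)) * ?t i"
        by (rule Lim_transform_eventually)
    qed
    have "((\<lambda>i. inverse (qpoch (q ^ 2) (q ^ 2)) * ?t i) has_sum (inverse (qpoch (q ^ 2) (q ^ 2)) * theta q z)) UNIV"
      by (intro has_sum_cmult_right theta_has_sum q)
    then show "((\<lambda>X. \<Sum>i\<in>X. inverse (qpoch (q ^ 2) (q ^ 2)) * ?t i) \<longlongrightarrow>
        inverse (qpoch (q ^ 2) (q ^ 2)) * theta q z) (finite_subsets_at_top UNIV)"
      by (simp add: has_sum_def)
  qed auto
  moreover have "P \<longlonglongrightarrow> qpoch (- (z * q)) (q ^ 2) * qpoch (- (q / z)) (q ^ 2)"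
    using tendsto_mult[OF qpoch_LIMSEQ[OF q2, of "- (z * q)"] qpoch_LIMSEQ[OF q2, of "- (q / z)"]]
    by (simp add: P_def)
  ultimately have "inverse (qpoch (q ^ 2) (q ^ 2)) * theta q z =
      qpoch (- (z * q)) (q ^ 2) * qpoch (- (q / z)) (q ^ 2)"
    by (rule LIMSEQ_unique)
  then show ?thesis
    using qpoch_nonzero[OF q2 q2] by (simp add: field_simps)
qed

section \<open>Products of two theta series\<close>

text \<open>Summability of complex families is absolute, so the product family is absolutely
  summable and may be summed iteratedly.\<close>

lemma has_sum_mult_complex:
  fixes f :: "'a \<Rightarrow> complex" and g :: "'b \<Rightarrow> complex"
  assumes "(f has_sum a) A" "(g has_sum b) B"
  shows "((\<lambda>(x, y). f x * g y) has_sum (a * b)) (A \<times> B)"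
proof (rule has_sum_SigmaI)
  show "((\<lambda>y. case (x, y) of (x, y) \<Rightarrow> f x * g y) has_sum (f x * b)) B" for x
    using has_sum_cmult_right[OF assms(2), of "f x"] by simp
  show "((\<lambda>x. f x * b) has_sum (a * b)) A"
    by (rule has_sum_cmult_left[OF assms(1)])
  have "f summable_on A" "g summable_on B"
    using assms by (auto simp: summable_on_def)
  then have abs: "(\<lambda>x. norm (f x)) summable_on A" "(\<lambda>y. norm (g y)) summable_on B"
    by (auto simp: summable_on_iff_abs_summable_on_complex)
  have "(\<lambda>z. norm (case z of (x, y) \<Rightarrow> f x * g y)) summable_on A \<times> B"
  proof (rule summable_on_SigmaI)
    show "((\<lambda>y. norm (case (x, y) of (x, y) \<Rightarrow> f x * g y)) has_sum
        (norm (f x) * infsum (\<lambda>y. norm (g y)) B)) B" for x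
      using has_sum_cmult_right[OF has_sum_infsum[OF abs(2)], of "norm (f x)"]
      by (simp add: norm_mult)
    show "(\<lambda>x. norm (f x) * infsum (\<lambda>y. norm (g y)) B) summable_on A"
      by (rule summable_on_cmult_left[OF abs(1)])
  qed auto
  then show "(\<lambda>(x, y). f x * g y) summable_on A \<times> B"
    by (rule abs_summable_summable)
qed

lemma neg_powi: "(- w :: complex) powi n = (-1) powi n * w powi n"
  by (simp add: power_int_minus_left)

lemma sign_powi_diff: "(-1 :: complex) powi (a - b) = (-1) powi (a + b)"
  by (simp add: power_int_minus_left)

lemma square_powi: "(Q ^ 2 :: complex) powi n = Q powi (2 * n)"
  by (simp add: power_int_mult)

lemma theta_mult_has_sum:
  assumes "norm q < 1"
  shows "((\<lambda>(m, n). q powi (m * m) * x powi m * (q powi (n * n) * y powi n)) has_sum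
           (theta q x * theta q y)) UNIV"
  using has_sum_mult_complex[OF theta_has_sum theta_has_sum, OF assms assms, of x y] by simp

text \<open>The summand of each of the following two sums vanishes unless \<open>m\<close> and \<open>n\<close> have equal,
  respectively opposite, parity; these index pairs are parametrised by \<open>(a + b, a - b)\<close>
  and \<open>(a + b - 1, a - b)\<close>, which separates the variables.\<close>

lemma theta_mult_add:
  assumes Q: "norm Q < 1" "Q \<noteq> 0" and xy: "x \<noteq> 0" "y \<noteq> 0"
  shows "theta Q x * theta Q (-y) + theta Q (-x) * theta Q y =
         2 * (theta (Q ^ 2) (- (x * y)) * theta (Q ^ 2) (- (x / y)))"
proof -
  have Q2: "norm (Q ^ 2) < 1"
    using Q by (simp add: norm_power power_less_one_iff)
  define G where "G = (\<lambda>(m :: int, n :: int). Q powi (m * m) * x powi m * (Q powi (n * n) * y powi n) *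
      ((-1) powi n + (-1) powi m))"
  define h where "h = (\<lambda>(a :: int, b :: int). (a + b, a - b))"
  have inj: "inj h"
    by (auto simp: inj_on_def h_def)
  have "((\<lambda>z. (case z of (m, n) \<Rightarrow> Q powi (m * m) * x powi m * (Q powi (n * n) * (-y) powi n)) +
      (case z of (m, n) \<Rightarrow> Q powi (m * m) * (-x) powi m * (Q powi (n * n) * y powi n))) has_sum
      (theta Q x * theta Q (-y) + theta Q (-x) * theta Q y)) UNIV"
    by (intro has_sum_add theta_mult_has_sum Q)
  also have "(\<lambda>z. (case z of (m, n) \<Rightarrow> Q powi (m * m) * x powi m * (Q powi (n * n) * (-y) powi n)) +
      (case z of (m, n) \<Rightarrow> Q powi (m * m) * (-x) powi m * (Q powi (n * n) * y powi n))) = G"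
    by (auto simp: G_def neg_powi[of x] neg_powi[of y] algebra_simps)
  finally have "(G has_sum (theta Q x * theta Q (-y) + theta Q (-x) * theta Q y)) UNIV" .
  also have "?this \<longleftrightarrow> (G has_sum (theta Q x * theta Q (-y) + theta Q (-x) * theta Q y)) (range h)"
  proof (rule has_sum_cong_neutral)
    fix z assume z: "z \<in> UNIV - range h"
    obtain m n where mn: "z = (m, n)" by force
    have "odd (m - n)"
    proof
      assume "even (m - n)"
      then obtain b where "m - n = 2 * b" by (elim evenE)
      then have "z = h (n + b, b)" by (simp add: h_def mn)
      with z show False by blast
    qed
    then show "G z = 0"
      by (auto simp: G_def mn power_int_minus_left)
  qed auto
  also have "\<dots> \<longleftrightarrow> ((G \<circ> h) has_sum (theta Q x * theta Q (-y) + theta Q (-x) * theta Q y)) UNIV"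
    by (rule has_sum_reindex[OF inj])
  also have "G \<circ> h = (\<lambda>z. 2 * (case z of (a, b) \<Rightarrow> (Q ^ 2) powi (a * a) * (- (x * y)) powi a *
      ((Q ^ 2) powi (b * b) * (- (x / y)) powi b)))"
  proof
    fix z :: "int \<times> int"
    obtain a b where z: "z = (a, b)" by force
    \<comment> \<open>The cross terms cancel in (a+b)^2 + (a-b)^2, which decouples \<open>a\<close>
      from \<open>b\<close> and doubles the exponents, hence the nome Q^2.\<close>
    have "Q powi ((a + b) * (a + b)) * Q powi ((a - b) * (a - b)) =
        Q powi (2 * (a * a)) * Q powi (2 * (b * b))"
      using Q by (simp add: power_int_add[symmetric] algebra_simps)
    moreover have "x powi (a + b) * y powi (a - b) = (x * y) powi a * (x / y) powi b"
      using xy by (simp add: power_int_add power_int_diff power_int_mult_distrib power_int_divide_distrib)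
    moreover have "(-1 :: complex) powi (a - b) + (-1) powi (a + b) = 2 * ((-1) powi a * (-1) powi b)"
      by (simp add: sign_powi_diff power_int_add)
    ultimately show "(G \<circ> h) z = 2 * (case z of (a, b) \<Rightarrow> (Q ^ 2) powi (a * a) *
        (- (x * y)) powi a * ((Q ^ 2) powi (b * b) * (- (x / y)) powi b))"
      unfolding neg_powi[of "x * y"] neg_powi[of "x / y"] square_powi
      by (simp add: G_def h_def z) algebra
  qed
  finally have "((\<lambda>z. 2 * (case z of (a, b) \<Rightarrow> (Q ^ 2) powi (a * a) * (- (x * y)) powi a *
      ((Q ^ 2) powi (b * b) * (- (x / y)) powi b))) has_sum
      (theta Q x * theta Q (-y) + theta Q (-x) * theta Q y)) UNIV" .
  moreover have "((\<lambda>z. 2 * (case z of (a, b) \<Rightarrow> (Q ^ 2) powi (a * a) * (- (x * y)) powi a *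
      ((Q ^ 2) powi (b * b) * (- (x / y)) powi b))) has_sum
      (2 * (theta (Q ^ 2) (- (x * y)) * theta (Q ^ 2) (- (x / y))))) UNIV"
    by (intro has_sum_cmult_right theta_mult_has_sum Q2)
  ultimately show ?thesis
    by (rule has_sum_unique)
qed

lemma theta_mult_diff:
  assumes Q: "norm Q < 1" "Q \<noteq> 0" and xy: "x \<noteq> 0" "y \<noteq> 0"
  shows "theta Q x * theta Q (-y) - theta Q (-x) * theta Q y =
         2 * (Q / x) * (theta (Q ^ 2) (- (x * y / Q ^ 2)) * theta (Q ^ 2) (- (x / y / Q ^ 2)))"
proof -
  have Q2: "norm (Q ^ 2) < 1"
    using Q by (simp add: norm_power power_less_one_iff)
  define G where "G = (\<lambda>(m :: int, n :: int). Q powi (m * m) * x powi m * (Q powi (n * n) * y powi n) *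
      ((-1) powi n - (-1) powi m))"
  define h where "h = (\<lambda>(a :: int, b :: int). (a + b - 1, a - b))"
  have inj: "inj h"
    by (auto simp: inj_on_def h_def)
  have "((\<lambda>z. (case z of (m, n) \<Rightarrow> Q powi (m * m) * x powi m * (Q powi (n * n) * (-y) powi n)) +
      (- 1) * (case z of (m, n) \<Rightarrow> Q powi (m * m) * (-x) powi m * (Q powi (n * n) * y powi n))) has_sum
      (theta Q x * theta Q (-y) + (- 1) * (theta Q (-x) * theta Q y))) UNIV"
    by (intro has_sum_add has_sum_cmult_right theta_mult_has_sum Q)
  also have "(\<lambda>z. (case z of (m, n) \<Rightarrow> Q powi (m * m) * x powi m * (Q powi (n * n) * (-y) powi n)) +
      (- 1) * (case z of (m, n) \<Rightarrow> Q powi (m * m) * (-x) powi m * (Q powi (n * n) * y powi n))) = G"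
    by (auto simp: G_def neg_powi[of x] neg_powi[of y] algebra_simps)
  finally have "(G has_sum (theta Q x * theta Q (-y) - theta Q (-x) * theta Q y)) UNIV"
    by simp
  also have "?this \<longleftrightarrow> (G has_sum (theta Q x * theta Q (-y) - theta Q (-x) * theta Q y)) (range h)"
  proof (rule has_sum_cong_neutral)
    fix z assume z: "z \<in> UNIV - range h"
    obtain m n where mn: "z = (m, n)" by force
    have "even (m - n)"
    proof (rule ccontr)
      assume "odd (m - n)"
      then obtain b where "m - n = 2 * b + 1" by (elim oddE)
      then have "z = h (n + b + 1, b + 1)" by (simp add: h_def mn)
      with z show False by blast
    qed
    then show "G z = 0"
      by (auto simp: G_def mn power_int_minus_left)
  qed auto
  also have "\<dots> \<longleftrightarrow> ((G \<circ> h) has_sum (theta Q x * theta Q (-y) - theta Q (-x) * theta Q y)) UNIV"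
    by (rule has_sum_reindex[OF inj])
  also have "G \<circ> h = (\<lambda>z. 2 * (Q / x) * (case z of (a, b) \<Rightarrow> (Q ^ 2) powi (a * a) * (- (x * y / Q ^ 2)) powi a *
      ((Q ^ 2) powi (b * b) * (- (x / y / Q ^ 2)) powi b)))"
  proof
    fix z :: "int \<times> int"
    obtain a b where z: "z = (a, b)" by force
    \<comment> \<open>The offset -1 leaves the constant 1, which gives the prefactor
      \<open>Q\<close>, and the linear terms -2a and -2b, which divide both theta arguments by
      Q^2.\<close>
    have "Q powi ((a + b - 1) * (a + b - 1)) * Q powi ((a - b) * (a - b)) =
        Q powi (1 + (2 * (a * a) - 2 * a) + (2 * (b * b) - 2 * b))"
      using Q by (simp add: power_int_add[symmetric] algebra_simps)
    also have "\<dots> = Q * (Q powi (2 * (a * a)) / Q powi (2 * a)) * (Q powi (2 * (b * b)) / Q powi (2 * b))"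
      using Q by (simp add: power_int_add power_int_diff)
    finally have 1: "Q powi ((a + b - 1) * (a + b - 1)) * Q powi ((a - b) * (a - b)) =
        Q * (Q powi (2 * (a * a)) / Q powi (2 * a)) * (Q powi (2 * (b * b)) / Q powi (2 * b))" .
    have 2: "x powi (a + b - 1) * y powi (a - b) = (x * y) powi a * (x / y) powi b / x"
      using xy by (simp add: mult_ac power_int_add power_int_diff power_int_mult_distrib power_int_divide_distrib)
    have 3: "(-1 :: complex) powi (a - b) - (-1) powi (a + b - 1) = 2 * ((-1) powi a * (-1) powi b)"
      by (simp add: sign_powi_diff power_int_add power_int_diff)
    have "(G \<circ> h) z = Q powi ((a + b - 1) * (a + b - 1)) * Q powi ((a - b) * (a - b)) *
        (x powi (a + b - 1) * y powi (a - b)) * ((-1) powi (a - b) - (-1) powi (a + b - 1))"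
      by (simp add: G_def h_def z mult_ac)
    also have "\<dots> = 2 * (Q / x) * (Q powi (2 * (a * a)) * ((-1) powi a * ((x * y) powi a / Q powi (2 * a))) *
        (Q powi (2 * (b * b)) * ((-1) powi b * ((x / y) powi b / Q powi (2 * b)))))"
      unfolding 1 2 3 by (simp add: mult_ac)
    finally show "(G \<circ> h) z = 2 * (Q / x) * (case z of (a, b) \<Rightarrow> (Q ^ 2) powi (a * a) *
        (- (x * y / Q ^ 2)) powi a * ((Q ^ 2) powi (b * b) * (- (x / y / Q ^ 2)) powi b))"
      unfolding neg_powi[of "x * y / Q ^ 2"] neg_powi[of "x / y / Q ^ 2"] 
        power_int_divide_distrib[of _ "Q ^ 2"] square_powi z by simp
  qed
  finally have "((\<lambda>z. 2 * (Q / x) * (case z of (a, b) \<Rightarrow> (Q ^ 2) powi (a * a) * (- (x * y / Q ^ 2)) powi a *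
      ((Q ^ 2) powi (b * b) * (- (x / y / Q ^ 2)) powi b))) has_sum
      (theta Q x * theta Q (-y) - theta Q (-x) * theta Q y)) UNIV" .
  moreover have "((\<lambda>z. 2 * (Q / x) * (case z of (a, b) \<Rightarrow> (Q ^ 2) powi (a * a) * (- (x * y / Q ^ 2)) powi a *
      ((Q ^ 2) powi (b * b) * (- (x / y / Q ^ 2)) powi b))) has_sum
      (2 * (Q / x) * (theta (Q ^ 2) (- (x * y / Q ^ 2)) * theta (Q ^ 2) (- (x / y / Q ^ 2))))) UNIV"
    by (intro has_sum_cmult_right theta_mult_has_sum Q2)
  ultimately show ?thesis
    by (rule has_sum_unique)
qed

section \<open>The relation for the Rogers-Ramanujan continued fraction\<close>

text \<open>The \<rho> of the overview: the continued fraction without its factor q^(1/5), hence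
  single-valued in \<open>q\<close>. Likewise \<open>rr_quot\<close> is L.\<close>

definition rr_ratio :: "complex \<Rightarrow> complex" where
  "rr_ratio q = qpoch q (q ^ 5) * qpoch (q ^ 4) (q ^ 5) / (qpoch (q ^ 2) (q ^ 5) * qpoch (q ^ 3) (q ^ 5))"

definition rr_quot :: "complex \<Rightarrow> complex" where
  "rr_quot q = rr_ratio (q ^ 2) / rr_ratio q ^ 2"

lemma norm_power_less_one:
  fixes q :: complex
  assumes "norm q < 1" "n > 0"
  shows "norm (q ^ n) < 1"
  using assms by (simp add: norm_power power_less_one_iff)

lemma qpoch_power_nonzero:
  assumes "norm q < 1" "k > 0" "m > 0"
  shows "qpoch (q ^ k) (q ^ m) \<noteq> 0"
  using assms by (intro qpoch_nonzero norm_power_less_one)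

lemma rr_ratio_nonzero:
  assumes "norm q < 1"
  shows "rr_ratio q \<noteq> 0"
  using qpoch_power_nonzero[OF assms, of _ 5] qpoch_power_nonzero[OF assms, of 1 5]
  by (simp add: rr_ratio_def)

lemma holomorphic_on_rr_ratio: "rr_ratio holomorphic_on ball 0 1"
  unfolding rr_ratio_def[abs_def]
  using holomorphic_on_qpoch[of 1 5] qpoch_power_nonzero[of _ _ 5]
  by (intro holomorphic_intros holomorphic_on_qpoch) auto

lemma rr_ratio_0: "rr_ratio 0 = 1"
  by (simp add: rr_ratio_def qpoch_def)

lemma holomorphic_on_rr_quot: "rr_quot holomorphic_on ball 0 1"
proof -
  have "(\<lambda>q. rr_ratio (q ^ 2)) holomorphic_on ball 0 1"
    by (rule holomorphic_on_compose_gen[OF _ holomorphic_on_rr_ratio, of "\<lambda>q. q ^ 2", unfolded o_def])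
       (auto intro!: holomorphic_intros norm_power_less_one simp del: norm_power)
  then show ?thesis
    unfolding rr_quot_def[abs_def]
    by (intro holomorphic_intros holomorphic_on_rr_ratio) (auto simp: rr_ratio_nonzero)
qed

text \<open>Together with the next lemma this expresses every product in the proof of the relation
  through (q^k; q^10).\<close>

lemma qpoch_split_mod_10:
  assumes "norm q < 1"
  shows "qpoch (q ^ k) (q ^ 5) = qpoch (q ^ k) (q ^ 10) * qpoch (q ^ (k + 5)) (q ^ 10)"
  using qpoch_split_even_odd[of "q ^ 5" "q ^ k"] norm_power_less_one[OF assms, of 5]
  by (simp add: power_add flip: power_mult)

lemma qpoch_minus_mod_10:
  assumes "norm q < 1"
  shows "qpoch (q ^ k) (q ^ 5) * qpoch (- (q ^ k)) (q ^ 5) = qpoch (q ^ (2 * k)) (q ^ 10)"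
  using qpoch_mult_minus[of "q ^ 5" "q ^ k"] norm_power_less_one[OF assms, of 5]
  by (simp add: mult.commute[of 2] flip: power_mult)

lemma rr_quot_relation:
  assumes q: "norm q < 1" "q \<noteq> 0"
  shows "rr_quot q - 1 = q * rr_ratio q * rr_ratio (q ^ 2) ^ 2 * (rr_quot q + 1)"
proof -
  \<comment> \<open>A square root of \<open>q\<close> is taken because the first theta series have
    nome q^(5/2) = t^5.\<close>
  define t where "t = csqrt q"
  have tq: "t ^ 2 = q" by (simp add: t_def)
  have t0: "t \<noteq> 0" using q by (simp add: t_def)
  have t1: "norm t < 1"
  proof (rule ccontr)
    assume "\<not> norm t < 1"
    then have "norm (t ^ 2) \<ge> 1" by (simp add: norm_power)
    with tq q show False by simp
  qed
  have t5: "norm (t ^ 5) < 1" "t ^ 5 \<noteq> 0" and t10: "norm (t ^ 10) < 1" "t ^ 10 \<noteq> 0"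
    using t0 t1 norm_power_less_one by auto
  define e where "e = (\<lambda>k. qpoch (q ^ k) (q ^ 10))"
  define f where "f = (\<lambda>k. qpoch (- (q ^ k)) (q ^ 5))"
  define c where "c = qpoch (q ^ 5) (q ^ 5)"
  define d where "d = qpoch (q ^ 10) (q ^ 10)"
  have e: "e k \<noteq> 0" if "k > 0" for k
    unfolding e_def using q that by (intro qpoch_power_nonzero) auto
  have nz: "e 1 \<noteq> 0" "e 2 \<noteq> 0" "e 3 \<noteq> 0" "e 4 \<noteq> 0" "e 6 \<noteq> 0" "e 7 \<noteq> 0" "e 8 \<noteq> 0" "e 9 \<noteq> 0"
    by (rule e; simp)+
  have c0: "c \<noteq> 0"
    unfolding c_def using q by (intro qpoch_power_nonzero) auto
  have g: "qpoch (q ^ k) (q ^ 5) = e k * e (k + 5)" for k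
    unfolding e_def by (rule qpoch_split_mod_10[OF q(1)])
  have ef: "e k * e (k + 5) * f k = e (2 * k)" for k
    using qpoch_minus_mod_10[OF q(1), of k] by (simp only: g f_def e_def)
  \<comment> \<open>With the \<open>f k\<close> eliminated, the evaluations of L and \<rho> become
    rational identities in the nonzero \<open>e k\<close>.\<close>
  have f: "f 1 = e 2 / (e 1 * e 6)" "f 2 = e 4 / (e 2 * e 7)" "f 3 = e 6 / (e 3 * e 8)" "f 4 = e 8 / (e 4 * e 9)"
    using ef[of 1] ef[of 2] ef[of 3] ef[of 4] nz by (simp_all add: field_simps flip: numeral_2_eq_2)

  have theta5: "theta (t ^ 5) z = c * (qpoch (- a) (q ^ 5) * qpoch (- b) (q ^ 5))"
    if "z * t ^ 5 = a" "z * b = t ^ 5" for z a b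
  proof -
    have "z \<noteq> 0" using that t0 by auto
    moreover have "(t ^ 5) ^ 2 = q ^ 5" by (simp flip: tq power_mult)
    moreover have "t ^ 5 / z = b" using that \<open>z \<noteq> 0\<close> by (simp add: field_simps)
    ultimately show ?thesis
      using jacobi_triple_product[OF t5, of z] that by (simp add: c_def)
  qed
  have theta10: "theta (t ^ 10) (- z) = d * (qpoch a (q ^ 10) * qpoch b (q ^ 10))"
    if "z * t ^ 10 = a" "z * b = t ^ 10" for z a b
  proof -
    have "z \<noteq> 0" using that t0 by auto
    moreover have "(t ^ 10) ^ 2 = q ^ 10" by (simp flip: tq power_mult)
    moreover have "t ^ 10 / z = b" using that \<open>z \<noteq> 0\<close> by (simp add: field_simps)
    ultimately show ?thesis
      using jacobi_triple_product[OF t10, of "- z"] that by (simp add: d_def)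
  qed
  \<comment> \<open>The argument t^3 yields the exponents 4 and 1 modulo 5, since t^8 = q^4 and t^2
    = q; the argument t yields 3 and 2.\<close>
  have th: "theta (t ^ 5) (t ^ 3) = c * (f 4 * f 1)" "theta (t ^ 5) t = c * (f 3 * f 2)"
    "theta (t ^ 5) (- (t ^ 3)) = c * (e 4 * e 9 * (e 1 * e 6))"
    "theta (t ^ 5) (- t) = c * (e 3 * e 8 * (e 2 * e 7))"
    using theta5[of "t ^ 3" "q ^ 4" "q ^ 1"] theta5[of t "q ^ 3" "q ^ 2"]
      theta5[of "- (t ^ 3)" "- (q ^ 4)" "- (q ^ 1)"] theta5[of "- t" "- (q ^ 3)" "- (q ^ 2)"]
      g[of 1] g[of 2] g[of 3] g[of 4]
    by (simp_all add: f_def tq[symmetric] flip: power_mult power_add power_Suc power_Suc2)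
  have th': "theta (t ^ 10) (- (t ^ 3 * t)) = d * (e 7 * e 3)" 
    "theta (t ^ 10) (- (t ^ 3 / t)) = d * (e 6 * e 4)" 
    "theta (t ^ 10) (- (t ^ 3 * t / t ^ 10)) = d * (e 2 * e 8)" 
    "theta (t ^ 10) (- (t ^ 3 / t / t ^ 10)) = d * (e 1 * e 9)" 
    using theta10[of "t ^ 3 * t" "q ^ 7" "q ^ 3"] theta10[of "t ^ 3 / t" "q ^ 6" "q ^ 4"]
      theta10[of "t ^ 3 * t / t ^ 10" "q ^ 2" "q ^ 8"] theta10[of "t ^ 3 / t / t ^ 10" "q ^ 1" "q ^ 9"] t0
    by (simp_all add: e_def tq[symmetric] field_simps flip: power_mult power_add power_Suc power_Suc2 numeral_2_eq_2)
  have sq: "(t ^ 5) ^ 2 = t ^ 10" by (simp flip: power_mult)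
  \<comment> \<open>The theta products at (t^3, -t) and (-t^3, t) are c^2 X and c^2 Y; their sum and
    difference are the two parity identities with x = t^3 and y = t.\<close>
  define X where "X = f 4 * f 1 * (e 3 * e 8 * (e 2 * e 7))"
  define Y where "Y = e 4 * e 9 * (e 1 * e 6) * (f 3 * f 2)"
  have "c ^ 2 * (X + Y) = 2 * (d ^ 2 * (e 7 * e 3 * (e 6 * e 4)))"
    using theta_mult_add[OF t5, of "t ^ 3" t] t0 unfolding sq th th'
    by (simp add: X_def Y_def algebra_simps power2_eq_square)
  moreover have "c ^ 2 * (X - Y) = 2 * q * (d ^ 2 * (e 2 * e 8 * (e 1 * e 9)))"
  proof -
    have "t ^ 5 / t ^ 3 = q"
      using t0 by (simp add: tq[symmetric] field_simps flip: power_add)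
    then show ?thesis
      using theta_mult_diff[OF t5, of "t ^ 3" t] t0 unfolding sq th th'
      by (simp add: X_def Y_def algebra_simps power2_eq_square)
  qed
  \<comment> \<open>Cross-multiplying the evaluations of X + Y and X - Y eliminates
    \<open>d\<close>.\<close>
  ultimately have "c ^ 2 * ((X - Y) * (e 7 * e 3 * (e 6 * e 4))) =
      c ^ 2 * (q * (e 2 * e 8 * (e 1 * e 9)) * (X + Y))"
    by algebra
  then have XY: "(X - Y) * (e 7 * e 3 * (e 6 * e 4)) = q * (e 2 * e 8 * (e 1 * e 9)) * (X + Y)"
    using c0 by simp
  have Y0: "Y \<noteq> 0"
    unfolding Y_def f using nz by simp
  have ratio: "rr_ratio q = e 1 * e 6 * (e 4 * e 9) / (e 2 * e 7 * (e 3 * e 8))"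
    unfolding rr_ratio_def using g[of 1] g[of 2] g[of 3] g[of 4] by simp
  have ratio2: "rr_ratio (q ^ 2) = e 2 * e 8 / (e 4 * e 6)"
    by (simp add: rr_ratio_def e_def flip: power_mult)
  have L: "rr_quot q = X / Y"
    unfolding rr_quot_def ratio ratio2 X_def Y_def f using nz by (simp add: field_simps power2_eq_square)
  have R: "q * rr_ratio q * rr_ratio (q ^ 2) ^ 2 = q * (e 2 * e 8 * (e 1 * e 9)) / (e 7 * e 3 * (e 6 * e 4))"
    unfolding ratio ratio2 using nz by (simp add: field_simps power2_eq_square)
  have frac: "X / Y - 1 = (X - Y) / Y" "X / Y + 1 = (X + Y) / Y"
    using Y0 by (simp_all add: field_simps)
  have "X - Y = q * (e 2 * e 8 * (e 1 * e 9)) / (e 7 * e 3 * (e 6 * e 4)) * (X + Y)"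
    using XY nz by (simp add: field_simps)
  then show ?thesis
    unfolding L R frac by simp
qed

section \<open>Elimination of \<rho> and analytic continuation\<close>

lemma rr_quot_polynomial:
  assumes q: "norm q < 1"
  defines "l \<equiv> rr_quot q" and "m \<equiv> rr_quot (q ^ 2)"
  shows "1 + l - 2 * l * m - l * m ^ 2 + l ^ 2 * m ^ 2 = 0"
proof -
  define E where "E = (\<lambda>q. 1 + rr_quot q - 2 * rr_quot q * rr_quot (q ^ 2)
      - rr_quot q * rr_quot (q ^ 2) ^ 2 + rr_quot q ^ 2 * rr_quot (q ^ 2) ^ 2)"
  define F where "F = (\<lambda>q. (rr_quot q - 1) * rr_quot (q ^ 2) + (rr_quot q + 1))"
  have hol2: "(\<lambda>q. rr_quot (q ^ 2)) holomorphic_on ball 0 1"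
    by (rule holomorphic_on_compose_gen[OF _ holomorphic_on_rr_quot, of "\<lambda>q. q ^ 2", unfolded o_def])
       (auto intro!: holomorphic_intros norm_power_less_one simp del: norm_power)
  have E: "E holomorphic_on ball 0 1" and F: "F holomorphic_on ball 0 1"
    unfolding E_def F_def by (intro holomorphic_intros holomorphic_on_rr_quot hol2)+
  have EF: "E z * F z = 0" if z: "z \<in> ball 0 1" "z \<noteq> 0" for z
  proof -
    define r where "r = rr_ratio z"
    define L where "L = rr_quot z"
    define M where "M = rr_quot (z ^ 2)"
    have z2: "norm (z ^ 2) < 1" "z ^ 2 \<noteq> 0"
      using z norm_power_less_one[of z 2] by auto
    have r2: "rr_ratio (z ^ 2) = L * r ^ 2"
      using rr_ratio_nonzero[of z] z by (simp add: L_def r_def rr_quot_def)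
    have r4: "rr_ratio ((z ^ 2) ^ 2) = M * (L * r ^ 2) ^ 2"
      using rr_ratio_nonzero[of "z ^ 2"] z2 by (simp add: M_def r2[symmetric] rr_quot_def)
    have 1: "L - 1 = z * r * (L * r ^ 2) ^ 2 * (L + 1)"
      using rr_quot_relation[of z] z by (simp add: r2 flip: L_def r_def)
    have 2: "M - 1 = z ^ 2 * (L * r ^ 2) * (M * (L * r ^ 2) ^ 2) ^ 2 * (M + 1)"
      using rr_quot_relation[OF z2] unfolding r4 unfolding r2 M_def[symmetric] .
    \<comment> \<open>The variables \<open>z\<close> and \<open>r\<close> enter only through z r^5,
      linearly in relation 1 and squared in relation 2, so the square of relation 1 eliminates
      them.\<close>
    have "(L + 1) ^ 2 * (M - 1) = L * (z * r * (L * r ^ 2) ^ 2 * (L + 1)) ^ 2 * M ^ 2 * (M + 1)"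
      unfolding 2 by algebra
    then have "(L + 1) ^ 2 * (M - 1) = L * (L - 1) ^ 2 * M ^ 2 * (M + 1)"
      unfolding 1[symmetric] .
    then show ?thesis
      unfolding E_def F_def L_def[symmetric] M_def[symmetric] by algebra
  qed
  have "F 0 \<noteq> 0"
    by (simp add: F_def rr_quot_def rr_ratio_0)
  moreover have "isCont F 0"
    using holomorphic_on_imp_continuous_on[OF F] by (simp add: continuous_on_eq_continuous_at)
  ultimately obtain \<epsilon> where \<epsilon>: "\<epsilon> > 0" "\<And>y. dist 0 y < \<epsilon> \<Longrightarrow> F y \<noteq> 0"
    using continuous_at_avoid[of 0 F 0] by auto
  \<comment> \<open>The centre is removed because \<open>EF\<close> assumes
    \<open>z \<noteq> 0\<close>; the punctured disc is still open and nonempty, as the identity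
    theorem requires.\<close>
  define U where "U = ball (0 :: complex) (min \<epsilon> 1) - {0}"
  have "E q = 0"
  proof (rule analytic_continuation_open[of U "ball 0 1" E "\<lambda>_. 0"])
    show "U \<noteq> {}"
    proof -
      have "of_real (min \<epsilon> 1 / 2) \<in> U"
        using \<epsilon> by (auto simp: U_def)
      then show ?thesis by blast
    qed
    show "E z = 0" if "z \<in> U" for z
    proof -
      have "z \<in> ball 0 1" "z \<noteq> 0" "F z \<noteq> 0"
        using that \<epsilon>(2) by (auto simp: U_def)
      with EF show ?thesis by (metis mult_eq_0_iff)
    qed
  qed (use E q in \<open>auto simp: U_def\<close>)
  then show ?thesis by (simp add: E_def l_def m_def)
qed

section \<open>Return from the nome to \<tau>\<close>

lemma norm_nome_less_one:
  assumes "Im \<tau> > 0"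
  shows "norm (nome \<tau>) < 1"
  using assms by (simp add: nome_def)

lemma nome_double: "nome (2 * \<tau>) = nome \<tau> ^ 2"
  by (simp add: nome_def mult_ac flip: exp_double)

lemma rogers_ramanujan_eq:
  assumes "Im \<tau> > 0"
  shows "rogers_ramanujan \<tau> = exp (2 * of_real pi * \<i> * \<tau> / 5) * rr_ratio (nome \<tau>)"
proof -
  define q where "q = nome \<tau>"
  have q: "norm q < 1" unfolding q_def by (rule norm_nome_less_one[OF assms])
  then have q5: "norm (q ^ 5) < 1" by (rule norm_power_less_one) simp
  \<comment> \<open>With \<open>Suc n\<close> for n the exponents are 5n+4, 5n+1, 5n+3 and 5n+2 for
    n from 0, so each product starts as the matching \<open>qpoch\<close> does.\<close>
  have pw: "q ^ (5 * Suc n - 1) = q ^ 4 * (q ^ 5) ^ n" "q ^ (5 * Suc n - 4) = q * (q ^ 5) ^ n"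
    "q ^ (5 * Suc n - 2) = q ^ 3 * (q ^ 5) ^ n" "q ^ (5 * Suc n - 3) = q ^ 2 * (q ^ 5) ^ n" for n
    by (simp_all flip: power_mult power_add power_Suc)
  have conv: "convergent_prod (\<lambda>n. 1 - a * (q ^ 5) ^ n)" for a
    by (rule convergent_prod_qpoch[OF q5])
  have "(\<Prod>n. ((1 - q ^ (5 * Suc n - 1)) * (1 - q ^ (5 * Suc n - 4))) /
          ((1 - q ^ (5 * Suc n - 2)) * (1 - q ^ (5 * Suc n - 3)))) =
        qpoch (q ^ 4) (q ^ 5) * qpoch q (q ^ 5) / (qpoch (q ^ 3) (q ^ 5) * qpoch (q ^ 2) (q ^ 5))"
    unfolding pw qpoch_def
    by (simp add: prodinf_divide[symmetric] prodinf_mult[symmetric] conv convergent_prod_mult)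
  then show ?thesis
    by (simp add: rogers_ramanujan_def rr_ratio_def q_def mult_ac)
qed

lemma rr_l_eq_rr_quot:
  assumes "Im \<tau> > 0"
  shows "rr_l \<tau> = rr_quot (nome \<tau>)"
proof -
  \<comment> \<open>Doubling \<tau> squares the factor q^(1/5), which then cancels against the
    squared denominator of \<open>rr_l\<close>.\<close>
  have "exp (2 * of_real pi * \<i> * (2 * \<tau>) / 5) = exp (2 * of_real pi * \<i> * \<tau> / 5) ^ 2"
    by (simp add: mult_ac flip: exp_double)
  then show ?thesis
    using assms by (simp add: rr_l_def rr_quot_def rogers_ramanujan_eq nome_double power_mult_distrib)
qed

theorem theorem4p5:
  fixes \<tau> :: complex
  assumes "Im \<tau> > 0"
  shows "1 + rr_l \<tau> - 2 * rr_l \<tau> * rr_l (2 * \<tau>) - rr_l \<tau> * rr_l (2 * \<tau>) ^ 2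
           + rr_l \<tau> ^ 2 * rr_l (2 * \<tau>) ^ 2 = 0"
  using rr_quot_polynomial[OF norm_nome_less_one[OF assms]] assms
  by (simp add: rr_l_eq_rr_quot nome_double)

end
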